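(* Let $A:\mathbb{F}^d\to\mathbb{F}^d$ be a linear operator, let $W$ be a subspace of $\mathbb{F}^d$ with $P_W:\mathbb{F}^d\to\mathbb{F}^d$ the orthogonal projection onto $W$, and let $\{b_1,\dots,b_L\}\subset\mathbb{F}^d$ be a set of non-trivial (nonzero) spatial observational vectors. For $1\le j\le L$ let $\kappa_j\in\mathbb{F}[x]$ be the minimal $A$-conductor polynomial of $b_j$ into $V_j:=\sum_{i=1}^{j-1}Z(A;b_i)$ (with $V_1:=\{\mathbf{0}\}$). For $2\le j\le L$ let $q_j^i\in\mathbb{F}[x]$, $1\le i\le j-1$, be polynomials such that $$\kappa_j(A)b_j=q_j^1(A)b_1+\dots+q_j^{j-1}(A)b_{j-1},$$ and define $$g_j:=\widehat{\kappa_j}(A)b_j-\sum_{i=1}^{j-1}\widehat{q_j^i}(A)b_i,\qquad 1\le j\le L.$$ Then the set $\{b_1,\dots,b_L\}$ is complete for the source recovery problem (for $A$ and $W$) if and only if $L\ge\dim(W)$ and $$\mathrm{span}\{P_W(g_j): 1\le j\le L\}=W.$$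
   Context: $\mathbb{F}$ is $\mathbb{R}$ or $\mathbb{C}$, and $\langle x,y\rangle=y^*x$ is the canonical inner product on $\mathbb{F}^d$. $Z(A;b):=\mathrm{span}\{A^n b: n\in\mathbb{N}_0\}$. For $p\in\mathbb{F}[x]$, $\widehat{p}(x):=\frac{p(x)-p(1)}{x-1}\in\mathbb{F}[x]$. For an $A$-invariant subspace $V\subseteq\mathbb{F}^d$ and $b\in\mathbb{F}^d$, the minimal $A$-conductor of $b$ into $V$ is the unique monic generator of the ideal $\{p\in\mathbb{F}[x]: p(A)b\in V\}$; in particular $\kappa_1$ is the minimal $A$-annihilating polynomial of $b_1$, i.e. the monic polynomial $m_{b_1}$ of least degree with $m_{b_1}(A)b_1=\mathbf{0}$. Source recovery problem: given $A$ with adjoint $A^*$, a subspace $W\subseteq\mathbb{F}^d$ and vectors $b_1,\dots,b_L\in\mathbb{F}^d$ (called spatial observational vectors), consider the dynamics $x(n+1)=A^*x(n)+\omega$, $n\in\mathbb{N}_0$, $x(0)=x_0$, where the constant source $\omega\in W$ and the initial state $x_0\in\mathbb{F}^d$ are unknown, with measurements $y_\ell(n)=\langle x(n),b_\ell\rangle$, $1\le\ell\le L$. The set $\{b_1,\dots,b_L\}$ is complete if every $\omega\in W$ can be recovered, regardless of $x_0$, by finitely many linear operations from finitely many measurements; that is, there exist $T\in\mathbb{N}_0$ and vectors $u_{n,\ell}\in\mathbb{F}^d$ ($0\le n\le T$, $1\le\ell\le L$) such that $\omega=\sum_{n,\ell}y_\ell(n)\,u_{n,\ell}$ for all $x_0\in\mathbb{F}^d$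 and all $\omega\in W$. *)

theory Defs
  imports "HOL-Analysis.Analysis" "HOL-Computational_Algebra.Polynomial"
begin

text \<open>
  The scalar field is the real or the complex numbers. Up to isomorphism these are the only two
  models of the following class: by the Gelfand--Mazur theorem a commutative real normed field is
  isomorphic to one of them, and the last axiom then forces \<open>conj\<close> to be the identity or
  complex conjugation.
\<close>

class real_or_complex = real_normed_field +
  fixes conj :: "'a \<Rightarrow> 'a"
  assumes conj_add: "conj (x + y) = conj x + conj y"
    and conj_mult_self: "conj x * x = (norm x)\<^sup>2 *\<^sub>R 1"

instantiation real :: real_or_complex
begin

definition conj_real :: "real \<Rightarrow> real" where "conj_real x = x"

instance
  by standard (simp_all add: conj_real_def power2_eq_square)

end

instantiation complex :: real_or_complex
begin

definition conj_complex :: "complex \<Rightarrow> complex" where "conj_complex = cnj"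

instance
  by standard (simp_all add: conj_complex_def scaleR_conv_of_real complex_norm_square mult.commute del: of_real_power)

end

text \<open>The canonical inner product \<open>y\<^sup>* x\<close>, linear in the first argument.\<close>

definition inner_F :: "'a::real_or_complex ^ 'd \<Rightarrow> 'a ^ 'd \<Rightarrow> 'a" where
  "inner_F x y = (\<Sum>i\<in>UNIV. conj (y $ i) * x $ i)"

definition adjoint_F ::
  "('a::real_or_complex ^ 'd \<Rightarrow> 'a ^ 'd) \<Rightarrow> 'a ^ 'd \<Rightarrow> 'a ^ 'd" where
  "adjoint_F A = (THE B. \<forall>x y. inner_F (A x) y = inner_F x (B y))"

definition orth_proj ::
  "('a::real_or_complex ^ 'd) set \<Rightarrow> 'a ^ 'd \<Rightarrow> 'a ^ 'd" where
  "orth_proj W x = (THE y. y \<in> W \<and> (\<forall>w\<in>W. inner_F (x - y) w = 0))"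

text \<open>\<open>poly_op p A v\<close> is \<open>p(A) v\<close>.\<close>

definition poly_op ::
  "'a::field poly \<Rightarrow> ('a ^ 'd \<Rightarrow> 'a ^ 'd) \<Rightarrow> 'a ^ 'd \<Rightarrow> 'a ^ 'd" where
  "poly_op p A v = (\<Sum>k\<le>degree p. coeff p k *s (A ^^ k) v)"

definition cyclic_subspace ::
  "('a::field ^ 'd \<Rightarrow> 'a ^ 'd) \<Rightarrow> 'a ^ 'd \<Rightarrow> ('a ^ 'd) set" where
  "cyclic_subspace A b = vec.span (range (\<lambda>n. (A ^^ n) b))"

definition poly_hat :: "'a::field poly \<Rightarrow> 'a poly" where
  "poly_hat p = (p - [:poly p 1:]) div [:-1, 1:]"

definition min_conductor ::
  "('a::field ^ 'd \<Rightarrow> 'a ^ 'd) \<Rightarrow> ('a ^ 'd) set \<Rightarrow> 'a ^ 'd \<Rightarrow> 'a poly" where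
  "min_conductor A V b =
     (THE k. lead_coeff k = 1 \<and> {p. poly_op p A b \<in> V} = {p. k dvd p})"

primrec source_state ::
  "('a::real_or_complex ^ 'd \<Rightarrow> 'a ^ 'd) \<Rightarrow> 'a ^ 'd \<Rightarrow> 'a ^ 'd \<Rightarrow> nat \<Rightarrow> 'a ^ 'd" where
  "source_state A \<omega> x0 0 = x0"
| "source_state A \<omega> x0 (Suc n) = adjoint_F A (source_state A \<omega> x0 n) + \<omega>"

definition measurement ::
  "('a::real_or_complex ^ 'd \<Rightarrow> 'a ^ 'd) \<Rightarrow> (nat \<Rightarrow> 'a ^ 'd) \<Rightarrow> 'a ^ 'd \<Rightarrow> 'a ^ 'd
     \<Rightarrow> nat \<Rightarrow> nat \<Rightarrow> 'a" where
  "measurement A b \<omega> x0 l n = inner_F (source_state A \<omega> x0 n) (b l)"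

definition complete_source_recovery ::
  "('a::real_or_complex ^ 'd \<Rightarrow> 'a ^ 'd) \<Rightarrow> ('a ^ 'd) set \<Rightarrow> nat \<Rightarrow> (nat \<Rightarrow> 'a ^ 'd)
     \<Rightarrow> bool" where
  "complete_source_recovery A W L b \<longleftrightarrow>
     (\<exists>(T::nat) (u :: nat \<Rightarrow> nat \<Rightarrow> 'a ^ 'd). \<forall>x0. \<forall>\<omega>\<in>W.
        \<omega> = (\<Sum>n\<le>T. \<Sum>l=1..L. measurement A b \<omega> x0 l n *s u n l))"

end

theory Submission
  imports Defs
begin

text \<open>
  By induction on \<open>n\<close>, a combination of measurements with coefficient polynomials \<open>p\<^sub>1, \<dots>, p\<^sub>L\<close>
  equals \<open>\<langle>x\<^sub>0, \<Sum>\<^sub>l p\<^sub>l(A) b\<^sub>l\<rangle> + \<langle>\<omega>, \<Sum>\<^sub>l hat p\<^sub>l(A) b\<^sub>l\<rangle>\<close>. It is independent of \<open>x\<^sub>0\<close> iff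
  \<open>(p\<^sub>1, \<dots>, p\<^sub>L)\<close> is a syzygy of \<open>b\<^sub>1, \<dots>, b\<^sub>L\<close>, so completeness means that the vectors
  \<open>\<Sum>\<^sub>l hat p\<^sub>l(A) b\<^sub>l\<close> coming from syzygies project onto \<open>W\<close>. The conductors make the module of
  syzygies triangular: it is generated by \<open>r\<^sub>j = (-q\<^sub>j\<^sup>1, \<dots>, -q\<^sub>j\<^sup>j\<^sup>-\<^sup>1, \<kappa>\<^sub>j, 0, \<dots>, 0)\<close>. Because
  \<open>hat (s p) = hat s p + s(1) hat p\<close>, the syzygy \<open>s r\<^sub>j\<close> contributes \<open>s(1) g\<^sub>j\<close>, and so these vectors
  form exactly the span of \<open>g\<^sub>1, \<dots>, g\<^sub>L\<close>.
\<close>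

section \<open>Inner product and orthogonal projection\<close>

lemma conj_zero [simp]: "conj (0::'a::real_or_complex) = 0"
  using conj_add[of "0::'a" 0] by simp

text \<open>The norm is multiplicative, so both sides agree after multiplication by
  \<open>x * y\<close>, which is then cancelled.\<close>

lemma conj_mult: "conj (x * y) = conj x * conj (y::'a::real_or_complex)"
proof (cases "x * y = 0")
  case False
  have "conj (x * y) * (x * y) = (conj x * x) * (conj y * y)"
    unfolding conj_mult_self by (simp add: norm_mult power_mult_distrib)
  also have "\<dots> = (conj x * conj y) * (x * y)"
    by (simp add: mult_ac)
  finally show ?thesis
    using False by (simp only: mult_cancel_right) simp
qed auto

lemma norm_conj: "norm (conj x) = norm (x::'a::real_or_complex)"
proof (cases "x = 0")
  case False
  have "norm (conj x) * norm x = (norm x)\<^sup>2"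
    unfolding norm_mult[symmetric] conj_mult_self by simp
  with False show ?thesis by (simp add: power2_eq_square)
qed simp

text \<open>Since \<open>conj\<close> preserves the norm, the class axiom gives the same value at
  \<open>x\<close> and at \<open>conj x\<close>; the common factor \<open>conj x\<close>
  cancels.\<close>

lemma conj_conj [simp]: "conj (conj x) = (x::'a::real_or_complex)"
proof (cases "x = 0")
  case False
  then have "conj x \<noteq> 0" using norm_conj[of x] by auto
  moreover have "conj (conj x) * conj x = x * conj x"
    using conj_mult_self[of "conj x"] conj_mult_self[of x] by (simp add: norm_conj mult.commute)
  ultimately show ?thesis by simp
qed simp

lemma conj_of_real [simp]: "conj (of_real t) = (of_real t::'a::real_or_complex)"
proof (cases "t = 0")
  case False
  have "conj (of_real t) * of_real t = (of_real t * of_real t::'a)"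
    unfolding conj_mult_self by (simp add: of_real_def power2_eq_square)
  with False show ?thesis by simp
qed simp

lemma conj_sum: "conj (sum f S) = (\<Sum>i\<in>S. conj (f i::'a::real_or_complex))"
  by (induction S rule: infinite_finite_induct) (simp_all add: conj_add)

section \<open>Sesquilinearity and definiteness of the inner product\<close>

lemma inner_F_add_left: "inner_F (x + y) z = inner_F x z + inner_F y z"
  by (simp add: inner_F_def distrib_left sum.distrib)

lemma inner_F_scale_left: "inner_F (c *s x) z = c * inner_F x z"
  by (simp add: inner_F_def sum_distrib_left mult_ac)

lemma inner_F_commute: "inner_F y x = conj (inner_F x y)"
  by (simp add: inner_F_def conj_sum conj_mult mult.commute)

lemma inner_F_add_right: "inner_F z (x + y) = inner_F z x + inner_F z y"
  by (metis inner_F_commute inner_F_add_left conj_add)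

lemma inner_F_scale_right: "inner_F z (c *s x) = conj c * inner_F z x"
  by (metis inner_F_commute inner_F_scale_left conj_mult)

lemma inner_F_zero_left [simp]: "inner_F 0 z = 0"
  by (simp add: inner_F_def)

lemma inner_F_zero_right [simp]: "inner_F z 0 = 0"
  by (simp add: inner_F_def)

lemma inner_F_diff_left: "inner_F (x - y) z = inner_F x z - inner_F y z"
  by (simp add: inner_F_def right_diff_distrib sum_subtractf)

lemma inner_F_diff_right: "inner_F z (x - y) = inner_F z x - inner_F z y"
  using inner_F_add_right[of z "x - y" y] by simp

lemma inner_F_sum_left: "inner_F (sum f S) z = (\<Sum>i\<in>S. inner_F (f i) z)"
  by (induction S rule: infinite_finite_induct) (simp_all add: inner_F_add_left)

lemma inner_F_sum_right: "inner_F z (sum f S) = (\<Sum>i\<in>S. inner_F z (f i))"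
  by (induction S rule: infinite_finite_induct) (simp_all add: inner_F_add_right)

text \<open>The scalar class carries no order, so positivity is expressed through an embedded real
  number.\<close>

lemma inner_F_self: "inner_F x x = of_real (\<Sum>i\<in>UNIV. (norm (x $ i))\<^sup>2)"
  by (simp add: inner_F_def conj_mult_self scaleR_conv_of_real)

lemma inner_F_self_eq_0 [simp]: "inner_F x x = 0 \<longleftrightarrow> x = 0"
  unfolding inner_F_self of_real_eq_0_iff
  by (subst sum_nonneg_eq_0_iff) (auto simp: vec_eq_iff)

lemma inner_F_left_eq_0: "(\<And>x. inner_F x y = 0) \<Longrightarrow> y = 0"
  using inner_F_self_eq_0 by blast

lemma inner_F_unit_vector:
  assumes "a \<noteq> 0"
  obtains c where "c \<noteq> 0" "inner_F (c *s a) (c *s a) = 1"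
proof -
  define r where "r = (\<Sum>i\<in>UNIV. (norm (a $ i))\<^sup>2)"
  have a: "inner_F a a = of_real r" unfolding r_def by (rule inner_F_self)
  have "r \<noteq> 0" using assms a inner_F_self_eq_0[of a] by auto
  moreover have "r \<ge> 0" unfolding r_def by (simp add: sum_nonneg)
  ultimately have "r > 0" by simp
  then have "inverse (sqrt r) * (inverse (sqrt r) * r) = 1"
    by (simp add: field_simps)
  then have "inner_F (of_real (inverse (sqrt r)) *s a) (of_real (inverse (sqrt r)) *s a) = 1"
    unfolding inner_F_scale_left inner_F_scale_right conj_of_real a
    by (metis of_real_1 of_real_mult)
  moreover have "of_real (inverse (sqrt r)) \<noteq> (0::'a)" using \<open>r > 0\<close> by simp
  ultimately show thesis by (rule that[rotated])
qed

section \<open>Orthonormal bases of subspaces\<close>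

definition orthonormal_F :: "('a::real_or_complex ^ 'd) set \<Rightarrow> bool" where
  "orthonormal_F B \<longleftrightarrow> finite B \<and> (\<forall>e\<in>B. \<forall>f\<in>B. inner_F e f = (if e = f then 1 else 0))"

lemma orthonormal_F_residual:
  assumes "orthonormal_F B" "f \<in> B"
  shows "inner_F (x - (\<Sum>e\<in>B. inner_F x e *s e)) f = 0"
proof -
  have "(\<Sum>e\<in>B. inner_F x e * inner_F e f) = (\<Sum>e\<in>B. if e = f then inner_F x e else 0)"
    using assms by (intro sum.cong) (auto simp: orthonormal_F_def)
  also have "\<dots> = inner_F x f"
    using assms by (simp add: orthonormal_F_def)
  finally show ?thesis
    by (simp add: inner_F_diff_left inner_F_sum_left inner_F_scale_left)
qed

text \<open>The residual is orthogonal to \<open>B\<close>, hence to its span, and it lies in that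
  span; so it is orthogonal to itself and vanishes.\<close>

lemma orthonormal_F_expansion:
  assumes B: "orthonormal_F B" and x: "x \<in> vec.span B"
  shows "x = (\<Sum>e\<in>B. inner_F x e *s e)"
proof -
  let ?r = "x - (\<Sum>e\<in>B. inner_F x e *s e)"
  have "vec.subspace {v. inner_F ?r v = 0}"
    by (rule vec.subspaceI) (auto simp: inner_F_add_right inner_F_scale_right)
  then have "vec.span B \<subseteq> {v. inner_F ?r v = 0}"
    using orthonormal_F_residual[OF B] by (intro vec.span_minimal) auto
  moreover have "?r \<in> vec.span B"
    by (intro vec.span_diff x vec.span_sum vec.span_scale vec.span_base)
  ultimately have "inner_F ?r ?r = 0" by blast
  then show ?thesis by simp
qed

text \<open>Gram-Schmidt, one generator at a time: the residual of the new generator is dropped if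
  it is zero and normalised otherwise.\<close>

lemma orthonormal_F_basis_of_span:
  assumes "finite S"
  shows "\<exists>B. orthonormal_F B \<and> vec.span B = vec.span (S :: ('a::real_or_complex ^ 'd) set)"
  using assms
proof (induction S)
  case empty
  show ?case by (rule exI[of _ "{}"]) (simp add: orthonormal_F_def)
next
  case (insert a S)
  then obtain B where B: "orthonormal_F B" "vec.span B = vec.span S" by blast
  define a' where "a' = a - (\<Sum>e\<in>B. inner_F a e *s e)"
  have sumB: "(\<Sum>e\<in>B. inner_F a e *s e) \<in> vec.span C" if "B \<subseteq> C" for C
    using that by (intro vec.span_sum vec.span_scale vec.span_base) auto
  have spanS: "vec.span (insert a S) = vec.span (insert a B)"
    using B(2) by (simp add: vec.span_insert)
  show ?case
  proof (cases "a' = 0")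
    case True
    then have "a \<in> vec.span B" using sumB[of B] by (simp add: a'_def)
    then show ?thesis using B spanS vec.span_redundant by metis
  next
    case False
    then obtain c where c: "c \<noteq> 0" "inner_F (c *s a') (c *s a') = 1"
      by (rule inner_F_unit_vector)
    have orth: "inner_F (c *s a') f = 0" "inner_F f (c *s a') = 0" if "f \<in> B" for f
    proof -
      show *: "inner_F (c *s a') f = 0"
        unfolding inner_F_scale_left a'_def orthonormal_F_residual[OF B(1) that] by simp
      show "inner_F f (c *s a') = 0" using * inner_F_commute[of f "c *s a'"] by simp
    qed
    have "orthonormal_F (insert (c *s a') B)"
      using B(1) c(2) orth unfolding orthonormal_F_def by auto
    moreover have "vec.span (insert (c *s a') B) = vec.span (insert a B)"
    proof (rule vec.span_eq[THEN iffD2], intro conjI)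
      have "c *s a' \<in> vec.span (insert a B)"
        unfolding a'_def
        by (intro vec.span_scale vec.span_diff[OF vec.span_base] sumB) auto
      then show "insert (c *s a') B \<subseteq> vec.span (insert a B)"
        by (auto intro: vec.span_base)
      have "a = inverse c *s (c *s a') + (\<Sum>e\<in>B. inner_F a e *s e)"
        using c(1) by (simp add: a'_def vector_smult_assoc)
      also have "\<dots> \<in> vec.span (insert (c *s a') B)"
        by (intro vec.span_add[OF vec.span_scale[OF vec.span_base]] sumB) auto
      finally show "insert a B \<subseteq> vec.span (insert (c *s a') B)"
        by (auto intro: vec.span_base)
    qed
    ultimately show ?thesis using spanS by metis
  qed
qed

lemma orthonormal_F_basis:
  assumes "vec.subspace (W :: ('a::real_or_complex ^ 'd) set)"
  obtains B where "orthonormal_F B" "B \<subseteq> W" "\<And>x. x \<in> W \<Longrightarrow> x = (\<Sum>e\<in>B. inner_F x e *s e)"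
proof -
  obtain S where S: "vec.independent S" "W = vec.span S"
    using vec.basis_exists[of W] vec.span_subspace[OF _ _ assms] by metis
  then have "finite S" by (auto simp: vec.finiteI_independent)
  then obtain B where "orthonormal_F B" "vec.span B = W"
    using orthonormal_F_basis_of_span S(2) by blast
  then show thesis
    using that orthonormal_F_expansion vec.span_superset by blast
qed

section \<open>Orthogonal projection and adjoint\<close>

lemma orth_proj_unique:
  assumes "vec.subspace W" "y \<in> W" "\<And>w. w \<in> W \<Longrightarrow> inner_F (x - y) w = 0"
  shows "orth_proj W x = y"
  unfolding orth_proj_def
proof (rule the_equality)
  fix z assume z: "z \<in> W \<and> (\<forall>w\<in>W. inner_F (x - z) w = 0)"
  \<comment> \<open>Two candidates differ by a vector of \<open>W\<close> that is orthogonal to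
    \<open>W\<close>, hence to itself.\<close>
  have "z - y \<in> W" using assms z by (simp add: vec.subspace_diff)
  then have "inner_F (x - y) (z - y) - inner_F (x - z) (z - y) = 0" using assms z by simp
  then have "inner_F (z - y) (z - y) = 0" by (simp add: inner_F_diff_left)
  then show "z = y" by simp
qed (use assms in auto)

lemma orth_proj_props:
  assumes W: "vec.subspace W"
  shows orth_proj_in: "orth_proj W x \<in> W"
    and orth_proj_residual: "w \<in> W \<Longrightarrow> inner_F (x - orth_proj W x) w = 0"
proof -
  obtain B where B: "orthonormal_F B" "B \<subseteq> W" "\<And>x. x \<in> W \<Longrightarrow> x = (\<Sum>e\<in>B. inner_F x e *s e)"
    using orthonormal_F_basis[OF W] by metis
  \<comment> \<open>The Fourier sum over an orthonormal basis of \<open>W\<close> is the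
    projection.\<close>
  let ?y = "\<Sum>e\<in>B. inner_F x e *s e"
  have y: "?y \<in> W"
    using B(2) W by (intro vec.subspace_sum vec.subspace_scale) auto
  have res: "inner_F (x - ?y) w = 0" if "w \<in> W" for w
  proof -
    have "inner_F (x - ?y) w = inner_F (x - ?y) (\<Sum>e\<in>B. inner_F w e *s e)"
      using B(3)[OF that] by simp
    also have "\<dots> = 0"
      using orthonormal_F_residual[OF B(1)]
      by (simp add: inner_F_sum_right inner_F_scale_right)
    finally show ?thesis .
  qed
  have "orth_proj W x = ?y" using orth_proj_unique[OF W y res] .
  then show "orth_proj W x \<in> W" "w \<in> W \<Longrightarrow> inner_F (x - orth_proj W x) w = 0"
    using y res by simp_all
qed

lemma inner_F_orth_proj_left:
  assumes "vec.subspace W" "w \<in> W"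
  shows "inner_F (orth_proj W x) w = inner_F x w"
  using orth_proj_residual[OF assms, of x] by (simp add: inner_F_diff_left)

lemma inner_F_orth_proj_right:
  assumes "vec.subspace W" "w \<in> W"
  shows "inner_F w (orth_proj W x) = inner_F w x"
  using inner_F_orth_proj_left[OF assms] by (metis inner_F_commute)

lemma linear_orth_proj:
  assumes W: "vec.subspace W"
  shows "Vector_Spaces.linear (*s) (*s) (orth_proj W)"
proof (intro Vector_Spaces.linear_iff[THEN iffD2] conjI allI vec.vector_space_axioms)
  fix x y c
  show "orth_proj W (x + y) = orth_proj W x + orth_proj W y"
    by (intro orth_proj_unique[OF W] vec.subspace_add[OF W] orth_proj_in[OF W])
       (simp add: inner_F_diff_left inner_F_add_left inner_F_orth_proj_left[OF W])
  show "orth_proj W (c *s x) = c *s orth_proj W x"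
    by (intro orth_proj_unique[OF W] vec.subspace_scale[OF W] orth_proj_in[OF W])
       (simp add: inner_F_diff_left inner_F_scale_left inner_F_orth_proj_left[OF W])
qed

text \<open>The definition puts the adjoint in the right slot; conjugate symmetry moves it to the
  left, the form that the state recursion calls for.\<close>

lemma adjoint_F_works:
  fixes A :: "'a::real_or_complex ^ 'd \<Rightarrow> 'a ^ 'd"
  assumes A: "Vector_Spaces.linear (*s) (*s) A"
  shows "inner_F (adjoint_F A x) y = inner_F x (A y)"
proof -
  interpret A: Vector_Spaces.linear "(*s)" "(*s)" A by fact
  \<comment> \<open>The coordinates of the adjoint image are forced by testing on the standard
    basis.\<close>
  let ?B = "\<lambda>y. \<chi> i. conj (inner_F (A (axis i 1)) y)"
  have B: "inner_F (A x) y = inner_F x (?B y)" for x y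
  proof -
    have "inner_F (A x) y = inner_F (A (\<Sum>i\<in>UNIV. x $ i *s axis i 1)) y"
      by (simp add: basis_expansion)
    also have "\<dots> = inner_F x (?B y)"
      unfolding A.sum A.scale inner_F_sum_left inner_F_scale_left
      by (simp add: inner_F_def[of x] mult.commute)
    finally show ?thesis .
  qed
  have "adjoint_F A = ?B"
    unfolding adjoint_F_def
  proof (rule the_equality)
    fix C assume C: "\<forall>x y. inner_F (A x) y = inner_F x (C y)"
    show "C = ?B"
    proof
      fix y
      have "C y - ?B y = 0"
        using B C by (intro inner_F_left_eq_0) (metis inner_F_diff_right diff_self)
      then show "C y = ?B y" by simp
    qed
  qed (use B in blast)
  then show ?thesis by (metis B inner_F_commute)
qed

section \<open>Polynomials in an operator and conductors\<close>

lemma poly_op_alt: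
  assumes "degree p \<le> n"
  shows "poly_op p A v = (\<Sum>k\<le>n. coeff p k *s (A ^^ k) v)"
  unfolding poly_op_def using assms
  by (intro sum.mono_neutral_left) (auto simp: coeff_eq_0)

lemma poly_op_0 [simp]: "poly_op 0 A v = 0"
  by (simp add: poly_op_def)

lemma poly_op_1 [simp]: "poly_op 1 A v = v"
  by (simp add: poly_op_def)

lemma poly_op_monom: "poly_op (monom c n) A v = c *s (A ^^ n) v"
proof -
  have "poly_op (monom c n) A v = (\<Sum>k\<le>n. if n = k then c *s (A ^^ k) v else 0)"
    by (subst poly_op_alt[OF degree_monom_le]) (intro sum.cong, auto)
  then show ?thesis by simp
qed

lemma poly_op_add: "poly_op (p + q) A v = poly_op p A v + poly_op q A v"
proof -
  let ?n = "max (degree p) (degree q)"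
  have "degree (p + q) \<le> ?n" by (rule degree_add_le_max)
  then show ?thesis
    by (simp add: poly_op_alt[of _ ?n] vec.scale_left_distrib sum.distrib)
qed

lemma poly_op_smult: "poly_op (smult c p) A v = c *s poly_op p A v"
  by (simp add: poly_op_alt[OF degree_smult_le] poly_op_def vec.scale_sum_right)

lemma poly_op_diff: "poly_op (p - q) A v = poly_op p A v - poly_op q A v"
  using poly_op_add[of "p - q" q A v] by simp

lemma poly_op_uminus: "poly_op (- p) A v = - poly_op p A v"
  using poly_op_diff[of 0 p A v] by simp

lemma poly_op_sum: "poly_op (sum f S) A v = (\<Sum>i\<in>S. poly_op (f i) A v)"
  by (induction S rule: infinite_finite_induct) (simp_all add: poly_op_add)

lemma funpow_linear:
  assumes "Vector_Spaces.linear (*s) (*s) (A :: 'a::field ^ 'd \<Rightarrow> 'a ^ 'd)"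
  shows "Vector_Spaces.linear (*s) (*s) (A ^^ n)"
proof (induction n)
  case 0
  show ?case by (simp add: vec.linear_id[unfolded id_def] id_def)
next
  case (Suc n)
  show ?case using Vector_Spaces.linear_compose[OF Suc assms] by (simp add: o_def)
qed

lemma linear_poly_op:
  assumes "Vector_Spaces.linear (*s) (*s) (A :: 'a::field ^ 'd \<Rightarrow> 'a ^ 'd)"
  shows "Vector_Spaces.linear (*s) (*s) (poly_op p A)"
  unfolding poly_op_def
  by (intro vec.linear_compose_sum ballI vec.linear_compose_scale_right funpow_linear assms)

lemma poly_op_mult:
  assumes A: "Vector_Spaces.linear (*s) (*s) (A :: 'a::field ^ 'd \<Rightarrow> 'a ^ 'd)"
  shows "poly_op (p * q) A v = poly_op p A (poly_op q A v)"
proof -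
  interpret A: Vector_Spaces.linear "(*s)" "(*s)" A by fact
  \<comment> \<open>Horner's rule: multiplication by the variable becomes one application of
    \<open>A\<close>, pulled out of the sum by linearity.\<close>
  have pCons: "poly_op (pCons a p) A v = a *s v + A (poly_op p A v)" for a p v
  proof -
    have "poly_op (pCons a p) A v = (\<Sum>k\<le>Suc (degree p). coeff (pCons a p) k *s (A ^^ k) v)"
      by (rule poly_op_alt[OF degree_pCons_le])
    then show ?thesis
      by (simp add: sum.atMost_Suc_shift poly_op_def A.sum A.scale del: sum.atMost_Suc)
  qed
  show ?thesis
    by (induction p) (simp_all add: pCons poly_op_add poly_op_smult)
qed

lemma poly_op_mem_cyclic: "poly_op p A b \<in> cyclic_subspace A b"
  unfolding poly_op_def cyclic_subspace_def
  by (intro vec.span_sum vec.span_scale vec.span_base) auto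

section \<open>The hat operation, handled by cancelling \<open>x - 1\<close>\<close>

lemma poly_hat_eqI:
  assumes "[:-1, 1:] * h = p - [:poly p 1:]"
  shows "poly_hat p = h"
proof -
  have "[:-1, 1:] * h div [:-1, 1:] = h" by (rule nonzero_mult_div_cancel_left) simp
  then show ?thesis by (simp only: poly_hat_def assms)
qed

lemma poly_hat_mult_cancel: "[:-1, 1:] * poly_hat p = p - [:poly p 1:]"
  unfolding poly_hat_def
  by (rule dvd_mult_div_cancel) (simp add: dvd_iff_poly_eq_0)

lemma poly_hat_0 [simp]: "poly_hat 0 = 0"
  by (rule poly_hat_eqI) simp

lemma poly_hat_1 [simp]: "poly_hat 1 = 0"
  by (rule poly_hat_eqI) (simp add: one_pCons)

lemma poly_hat_X [simp]: "poly_hat [:0, 1:] = 1"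
  by (rule poly_hat_eqI) simp

lemma poly_hat_add: "poly_hat (p + q) = poly_hat p + poly_hat q"
  by (rule poly_hat_eqI)
     (simp add: distrib_left poly_hat_mult_cancel del: mult_pCons_left)

lemma poly_hat_diff: "poly_hat (p - q) = poly_hat p - poly_hat q"
  using poly_hat_add[of "p - q" q] by simp

lemma poly_hat_uminus: "poly_hat (- p) = - poly_hat p"
  using poly_hat_diff[of 0 p] by simp

lemma poly_hat_sum: "poly_hat (sum f S) = (\<Sum>i\<in>S. poly_hat (f i))"
  by (induction S rule: infinite_finite_induct) (simp_all add: poly_hat_add)

text \<open>Split \<open>s p - s(1) p(1)\<close> as \<open>(s - s(1)) p + s(1) (p - p(1))\<close>
  and divide by \<open>x - 1\<close>.\<close>

lemma poly_hat_mult: "poly_hat (s * p) = poly_hat s * p + smult (poly s 1) (poly_hat p)"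
proof (rule poly_hat_eqI)
  have "[:-1, 1:] * (poly_hat s * p + smult (poly s 1) (poly_hat p))
      = ([:-1, 1:] * poly_hat s) * p + smult (poly s 1) ([:-1, 1:] * poly_hat p)"
    by (simp only: distrib_left mult.assoc mult_smult_right)
  also have "\<dots> = s * p - [:poly (s * p) 1:]"
    unfolding poly_hat_mult_cancel by (simp add: left_diff_distrib smult_diff_right)
  finally show "[:-1, 1:] * (poly_hat s * p + smult (poly s 1) (poly_hat p)) = s * p - [:poly (s * p) 1:]" .
qed

lemma poly_hat_smult: "poly_hat (smult c p) = smult c (poly_hat p)"
proof -
  have "poly_hat [:c:] = 0" by (rule poly_hat_eqI) simp
  then show ?thesis using poly_hat_mult[of "[:c:]" p] by simp
qed

section \<open>Annihilating polynomials and minimal conductors\<close>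

lemma exists_annihilating_poly:
  fixes A :: "'a::field ^ 'd \<Rightarrow> 'a ^ 'd"
  obtains p where "p \<noteq> 0" "poly_op p A b = 0"
proof (cases "inj (\<lambda>n. (A ^^ n) b)")
  case False
  then obtain m n where "m \<noteq> n" "(A ^^ m) b = (A ^^ n) b" by (auto simp: inj_def)
  then have "monom 1 m - monom 1 n \<noteq> (0::'a poly)" "poly_op (monom 1 m - monom 1 n) A b = 0"
    by (auto simp: poly_op_diff poly_op_monom poly_eq_iff intro!: exI[of _ m])
  then show thesis by (rule that)
next
  case True
  \<comment> \<open>In finite dimension an infinite orbit is linearly dependent.\<close>
  then have "infinite (range (\<lambda>n. (A ^^ n) b))" by (simp add: finite_image_iff)
  then have "vec.dependent (range (\<lambda>n. (A ^^ n) b))"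
    using vec.finiteI_independent by blast
  then obtain T u v where T: "finite T" "T \<subseteq> range (\<lambda>n. (A ^^ n) b)" "(\<Sum>v\<in>T. u v *s v) = 0"
    "v \<in> T" "u v \<noteq> 0"
    unfolding vec.dependent_explicit by blast
  \<comment> \<open>Injectivity turns the vectors of the dependence into exponents, so its
    coefficients become those of a polynomial.\<close>
  define S where "S = (\<lambda>n. (A ^^ n) b) -` T"
  have S: "finite S" "T = (\<lambda>n. (A ^^ n) b) ` S"
    using T True by (auto simp: S_def finite_vimageI)
  have inj: "inj_on (\<lambda>n. (A ^^ n) b) S" using True inj_on_subset by blast
  define p where "p = (\<Sum>n\<in>S. monom (u ((A ^^ n) b)) n)"
  have "poly_op p A b = 0"
    using T(3) inj by (simp add: p_def poly_op_sum poly_op_monom S(2) sum.reindex)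
  moreover from T(4) S(2) obtain m where m: "m \<in> S" "v = (A ^^ m) b" by auto
  then have "coeff p m = u v"
    using S(1) by (simp add: p_def coeff_sum)
  then have "p \<noteq> 0" using T(5) by auto
  ultimately show thesis by (intro that)
qed

text \<open>Division with remainder makes a nonzero element of least degree generate the ideal. The
  conductor is a definite description, so the monic generator must also be shown unique.\<close>

lemma min_conductor_props:
  fixes A :: "'a::field ^ 'd \<Rightarrow> 'a ^ 'd"
  assumes A: "Vector_Spaces.linear (*s) (*s) A" and V: "vec.subspace V"
    and inv: "\<And>v. v \<in> V \<Longrightarrow> A v \<in> V"
  shows "poly_op p A b \<in> V \<longleftrightarrow> min_conductor A V b dvd p"
proof -
  have inv_poly: "poly_op r A v \<in> V" if "v \<in> V" for r v
  proof -
    have "(A ^^ n) v \<in> V" for n by (induction n) (use inv that in auto)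
    then show ?thesis unfolding poly_op_def
      by (intro vec.subspace_sum[OF V] vec.subspace_scale[OF V])
  qed
  obtain p0 where p0: "p0 \<noteq> 0" "poly_op p0 A b = 0"
    by (rule exists_annihilating_poly)
  define P where "P = (\<lambda>p. p \<noteq> 0 \<and> poly_op p A b \<in> V)"
  \<comment> \<open>An annihilating polynomial shows that the ideal is nonzero, so a least degree
    exists.\<close>
  have "P p0" using p0 V by (simp add: P_def vec.subspace_0)
  then obtain k0 where k0: "P k0" "\<And>p. P p \<Longrightarrow> degree k0 \<le> degree p"
    using ex_has_least_nat[of P p0 degree] by blast
  define k where "k = smult (inverse (lead_coeff k0)) k0"
  have k: "lead_coeff k = 1" "degree k = degree k0" "poly_op k A b \<in> V"
    using k0(1) by (auto simp: k_def P_def poly_op_smult vec.subspace_scale[OF V])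
  have ideal: "{p. poly_op p A b \<in> V} = {p. k dvd p}"
  proof (intro set_eqI, unfold mem_Collect_eq, rule iffI)
    fix p assume p: "poly_op p A b \<in> V"
    \<comment> \<open>The remainder stays in the ideal, and its smaller degree forces it to be
      zero.\<close>
    have "poly_op (p mod k) A b = poly_op p A b - poly_op ((p div k) * k) A b"
      by (simp add: minus_div_mult_eq_mod flip: poly_op_diff)
    then have "poly_op (p mod k) A b \<in> V"
      using p inv_poly[OF k(3)] by (simp add: poly_op_mult[OF A] vec.subspace_diff[OF V])
    then have "p mod k = 0"
      using k0(2)[of "p mod k"] k degree_mod_less[of k p] by (force simp: P_def)
    then show "k dvd p" by auto
  next
    fix p assume "k dvd p"
    then obtain s where "p = s * k" by (metis dvd_def mult.commute)
    then show "poly_op p A b \<in> V" using inv_poly[OF k(3)] by (simp add: poly_op_mult[OF A])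
  qed
  \<comment> \<open>Two monic generators divide each other, so their quotient is a constant with
    leading coefficient 1.\<close>
  have unique: "k' = k" if "lead_coeff k' = 1" "{p. k dvd p} = {p. k' dvd p}" for k'
  proof -
    have "k dvd k'" "k' dvd k"
      using that(2)[THEN eqset_imp_iff, of k] that(2)[THEN eqset_imp_iff, of k'] by simp_all
    then obtain s where s: "k' = k * s" by (auto simp: dvd_def)
    have "k \<noteq> 0" "k' \<noteq> 0" using k(1) that(1) by auto
    then have "degree k' = degree k"
      using \<open>k dvd k'\<close> \<open>k' dvd k\<close> by (intro antisym dvd_imp_degree_le)
    then have "degree s = 0" using s \<open>k' \<noteq> 0\<close> \<open>k \<noteq> 0\<close> by (auto simp: degree_mult_eq)
    moreover have "lead_coeff s = 1" using k(1) that(1) s by (simp add: lead_coeff_mult)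
    ultimately have "s = 1" by (auto elim!: degree_eq_zeroE simp: one_pCons)
    then show "k' = k" using s by simp
  qed
  have "min_conductor A V b = k"
    unfolding min_conductor_def ideal
    by (rule the_equality) (use k(1) in simp, elim conjE, rule unique)
  then show ?thesis using ideal[THEN eqset_imp_iff, of p] by simp
qed

section \<open>Invariance of sums of cyclic subspaces\<close>

lemma cyclic_subspace_invariant:
  fixes A :: "'a::field ^ 'd \<Rightarrow> 'a ^ 'd"
  assumes A: "Vector_Spaces.linear (*s) (*s) A" and v: "v \<in> cyclic_subspace A b"
  shows "A v \<in> cyclic_subspace A b"
proof -
  interpret A: Vector_Spaces.linear "(*s)" "(*s)" A by fact
  have "A v \<in> A ` vec.span (range (\<lambda>n. (A ^^ n) b))"
    using v by (auto simp: cyclic_subspace_def)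
  also have "\<dots> = vec.span (range (\<lambda>n. (A ^^ Suc n) b))"
    by (simp add: A.span_image[symmetric] image_image)
  also have "\<dots> \<subseteq> cyclic_subspace A b"
    unfolding cyclic_subspace_def by (rule vec.span_mono) (blast intro: rangeI)
  finally show ?thesis .
qed

text \<open>A sum of sets is the Minkowski sum, with \<open>{0}\<close> as empty case. This makes
  each \<open>V j\<close> of the theorem an invariant subspace, as
  \<open>min_conductor_props\<close> requires.\<close>

lemma sum_subspaces_props:
  fixes A :: "'a::field ^ 'd \<Rightarrow> 'a ^ 'd"
  assumes A: "Vector_Spaces.linear (*s) (*s) A" and "finite I"
    and "\<And>i. i \<in> I \<Longrightarrow> vec.subspace (U i)"
    and "\<And>i v. i \<in> I \<Longrightarrow> v \<in> U i \<Longrightarrow> A v \<in> U i"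
  shows "vec.subspace (\<Sum>i\<in>I. U i) \<and> (\<forall>v \<in> (\<Sum>i\<in>I. U i). A v \<in> (\<Sum>i\<in>I. U i))"
  using assms(2-)
proof (induction I)
  interpret A: Vector_Spaces.linear "(*s)" "(*s)" A by fact
  {
    case empty
    show ?case by (simp add: vec.subspace_0)
  next
    case (insert i I)
    have "vec.subspace {x + y |x y. x \<in> U i \<and> y \<in> (\<Sum>i\<in>I. U i)}"
      using insert by (intro vec.subspace_sums) auto
    moreover have "U i + (\<Sum>i\<in>I. U i) = {x + y |x y. x \<in> U i \<and> y \<in> (\<Sum>i\<in>I. U i)}"
      by (auto simp: set_plus_def)
    ultimately show ?case
      using insert by (fastforce simp: set_plus_def A.add)
  }
qed

lemma sum_mem_sum_sets:
  assumes "finite I" "\<And>i. i \<in> I \<Longrightarrow> f i \<in> U i"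
  shows "sum f I \<in> (\<Sum>i\<in>I. U i)"
  using assms by (induction I) (auto intro: set_plus_intro)

section \<open>Source recovery\<close>

text \<open>Moving the adjoint across the inner product replaces \<open>v\<close> by
  \<open>A v\<close>, so the induction needs \<open>v\<close> arbitrary; the source adds
  \<open>inner_F \<omega> v\<close>.\<close>

lemma measurement_monom:
  fixes A :: "'a::real_or_complex ^ 'd \<Rightarrow> 'a ^ 'd"
  assumes A: "Vector_Spaces.linear (*s) (*s) A"
  shows "inner_F (source_state A \<omega> x0 n) v
    = inner_F x0 (poly_op (monom 1 n) A v) + inner_F \<omega> (poly_op (poly_hat (monom 1 n)) A v)"
proof (induction n arbitrary: v)
  case 0
  show ?case by (simp add: monom_0 flip: one_pCons)
next
  case (Suc n)
  have X: "monom 1 (Suc n) = monom 1 n * [:0, 1 :: 'a:]"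
    by (simp add: monom_Suc mult.commute)
  have AX: "poly_op [:0, 1:] A v = A v"
    using poly_op_monom[of 1 1 A v] by (simp add: monom_Suc monom_0)
  \<comment> \<open>The product rule with second factor \<open>x\<close>: the trailing 1 accounts
    for the newly added source term.\<close>
  have "poly_hat (monom (1 :: 'a) (Suc n)) = poly_hat (monom 1 n) * [:0, 1:] + 1"
    unfolding X poly_hat_mult by (simp add: poly_monom one_pCons)
  then have "poly_op (poly_hat (monom 1 (Suc n))) A v
      = poly_op (poly_hat (monom 1 n)) A (A v) + v"
    by (simp only: poly_op_add poly_op_mult[OF A] AX poly_op_1)
  moreover have "poly_op (monom 1 (Suc n)) A v = poly_op (monom 1 n) A (A v)"
    unfolding X by (simp only: poly_op_mult[OF A] AX)
  ultimately show ?case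
    by (simp add: inner_F_add_left inner_F_add_right adjoint_F_works[OF A] Suc.IH)
qed

text \<open>The coefficients are conjugated because the inner product is conjugate linear in its
  second argument. The length \<open>T\<close> is independent of the degree, so that one
  \<open>T\<close> can serve all sensors.\<close>

lemma measurement_combination:
  fixes A :: "'a::real_or_complex ^ 'd \<Rightarrow> 'a ^ 'd"
  assumes A: "Vector_Spaces.linear (*s) (*s) A" and p: "p = (\<Sum>n\<le>T. monom (c n) n)"
  shows "(\<Sum>n\<le>T. conj (c n) * measurement A b \<omega> x0 l n)
    = inner_F x0 (poly_op p A (b l)) + inner_F \<omega> (poly_op (poly_hat p) A (b l))"
proof -
  have m: "monom (c n) n = smult (c n) (monom 1 n)" for n by (simp add: smult_monom)
  show ?thesis
    unfolding p measurement_def measurement_monom[OF A] m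
    by (simp add: poly_op_sum poly_op_smult poly_hat_sum poly_hat_smult inner_F_sum_right
      inner_F_scale_right distrib_left sum.distrib)
qed

text \<open>The vectors \<open>s\<close> for which \<open>\<langle>\<omega>, s\<rangle>\<close> is a combination of measurements in which the initial
  state cancels.\<close>

definition source_functionals ::
  "('a::field ^ 'd \<Rightarrow> 'a ^ 'd) \<Rightarrow> nat \<Rightarrow> (nat \<Rightarrow> 'a ^ 'd) \<Rightarrow> ('a ^ 'd) set" where
  "source_functionals A L b =
    {\<Sum>l=1..L. poly_op (poly_hat (p l)) A (b l) |p. (\<Sum>l=1..L. poly_op (p l) A (b l)) = 0}"

lemma subspace_source_functionals: "vec.subspace (source_functionals A L b)"
proof (rule vec.subspaceI)
  show "0 \<in> source_functionals A L b"
    unfolding source_functionals_def by (intro CollectI exI[of _ "\<lambda>_. 0"]) simp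
  fix x y c assume x: "x \<in> source_functionals A L b"
  then obtain p where p: "x = (\<Sum>l=1..L. poly_op (poly_hat (p l)) A (b l))"
    "(\<Sum>l=1..L. poly_op (p l) A (b l)) = 0"
    unfolding source_functionals_def by blast
  show "c *s x \<in> source_functionals A L b"
    unfolding source_functionals_def using p
    by (intro CollectI exI[of _ "\<lambda>l. smult c (p l)"])
       (simp add: poly_op_smult poly_hat_smult flip: vec.scale_sum_right)
  assume "y \<in> source_functionals A L b"
  then obtain r where r: "y = (\<Sum>l=1..L. poly_op (poly_hat (r l)) A (b l))"
    "(\<Sum>l=1..L. poly_op (r l) A (b l)) = 0"
    unfolding source_functionals_def by blast
  show "x + y \<in> source_functionals A L b"
    unfolding source_functionals_def using p r
    by (intro CollectI exI[of _ "\<lambda>l. p l + r l"])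
       (simp add: poly_op_add poly_hat_add sum.distrib)
qed

section \<open>Completeness as surjectivity onto \<open>W\<close>\<close>

lemma orth_proj_source_functionals_if_complete:
  fixes A :: "'a::real_or_complex ^ 'd \<Rightarrow> 'a ^ 'd"
  assumes A: "Vector_Spaces.linear (*s) (*s) A" and W: "vec.subspace W"
    and "complete_source_recovery A W L b"
  shows "orth_proj W ` source_functionals A L b = W"
proof (intro equalityI subsetI)
  fix w assume w: "w \<in> W"
  obtain T u where rec: "\<And>x0 \<omega>. \<omega> \<in> W \<Longrightarrow>
      \<omega> = (\<Sum>n\<le>T. \<Sum>l=1..L. measurement A b \<omega> x0 l n *s u n l)"
    using assms(3) unfolding complete_source_recovery_def by blast
  define p where "p = (\<lambda>l. \<Sum>n\<le>T. monom (conj (inner_F (u n l) w)) n)"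
  let ?z = "\<Sum>l=1..L. poly_op (p l) A (b l)"
  let ?s = "\<Sum>l=1..L. poly_op (poly_hat (p l)) A (b l)"
  \<comment> \<open>Pairing the recovery formula with \<open>w\<close> turns it into a scalar
    combination of measurements.\<close>
  have main: "inner_F \<omega> w = inner_F x0 ?z + inner_F \<omega> ?s" if "\<omega> \<in> W" for x0 \<omega>
  proof -
    have "inner_F \<omega> w
        = inner_F (\<Sum>n\<le>T. \<Sum>l=1..L. measurement A b \<omega> x0 l n *s u n l) w"
      using rec[OF that, of x0] by simp
    also have "\<dots> = (\<Sum>n\<le>T. \<Sum>l=1..L. inner_F (u n l) w * measurement A b \<omega> x0 l n)"
      by (simp add: inner_F_sum_left inner_F_scale_left mult.commute)
    also have "\<dots> = (\<Sum>l=1..L. \<Sum>n\<le>T. conj (conj (inner_F (u n l) w)) * measurement A b \<omega> x0 l n)"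
      by (subst sum.swap) simp
    also have "\<dots> = inner_F x0 ?z + inner_F \<omega> ?s"
      unfolding measurement_combination[OF A p_def[THEN fun_cong]]
      by (simp add: inner_F_sum_right sum.distrib)
    finally show ?thesis .
  qed
  \<comment> \<open>The source 0 isolates the initial state, so the \<open>p l\<close> form a
    syzygy.\<close>
  have "?z = 0" using main[OF vec.subspace_0[OF W]] by (intro inner_F_left_eq_0) simp
  then have s: "?s \<in> source_functionals A L b"
    unfolding source_functionals_def by (intro CollectI exI[of _ p]) simp
  have "inner_F (?s - w) v = 0" if "v \<in> W" for v
  proof -
    have "inner_F v (?s - w) = 0"
      using main[OF that, of 0] by (simp add: inner_F_diff_right)
    then show ?thesis using inner_F_commute[of "?s - w" v] by simp
  qed
  then have "orth_proj W ?s = w" by (rule orth_proj_unique[OF W w])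
  then show "w \<in> orth_proj W ` source_functionals A L b" using s by blast
qed (use orth_proj_in[OF W] in auto)

text \<open>A syzygy whose vector projects to the basis vector \<open>e\<close> yields the
  coordinate \<open>inner_F \<omega> e\<close> from measurements; the coordinates reassemble the
  source.\<close>

lemma complete_if_orth_proj_source_functionals:
  fixes A :: "'a::real_or_complex ^ 'd \<Rightarrow> 'a ^ 'd"
  assumes A: "Vector_Spaces.linear (*s) (*s) A" and W: "vec.subspace W"
    and surj: "orth_proj W ` source_functionals A L b = W"
  shows "complete_source_recovery A W L b"
proof -
  obtain B where B: "orthonormal_F B" "B \<subseteq> W" "\<And>x. x \<in> W \<Longrightarrow> x = (\<Sum>e\<in>B. inner_F x e *s e)"
    using orthonormal_F_basis[OF W] by metis
  have "\<forall>e\<in>B. \<exists>p. (\<Sum>l=1..L. poly_op (p l) A (b l)) = 0 \<and>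
      orth_proj W (\<Sum>l=1..L. poly_op (poly_hat (p l)) A (b l)) = e"
  proof
    fix e assume "e \<in> B"
    then have "e \<in> orth_proj W ` source_functionals A L b" using B(2) surj by blast
    then obtain s where s: "e = orth_proj W s" "s \<in> source_functionals A L b" by (rule imageE)
    from s(2) obtain p where "s = (\<Sum>l=1..L. poly_op (poly_hat (p l)) A (b l))"
      "(\<Sum>l=1..L. poly_op (p l) A (b l)) = 0"
      unfolding source_functionals_def by blast
    then show "\<exists>p. (\<Sum>l=1..L. poly_op (p l) A (b l)) = 0 \<and>
      orth_proj W (\<Sum>l=1..L. poly_op (poly_hat (p l)) A (b l)) = e"
      using s(1) by (intro exI[of _ p]) simp
  qed
  from bchoice[OF this] obtain p where p:
    "\<And>e. e \<in> B \<Longrightarrow> (\<Sum>l=1..L. poly_op (p e l) A (b l)) = 0"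
    "\<And>e. e \<in> B \<Longrightarrow> orth_proj W (\<Sum>l=1..L. poly_op (poly_hat (p e l)) A (b l)) = e"
    by blast
  \<comment> \<open>A crude common bound for all degrees involved.\<close>
  define T where "T = (\<Sum>e\<in>B. \<Sum>l=1..L. degree (p e l))"
  have T: "degree (p e l) \<le> T" if "e \<in> B" "l \<in> {1..L}" for e l
  proof -
    have "degree (p e l) \<le> (\<Sum>l=1..L. degree (p e l))"
      using that by (intro member_le_sum) auto
    also have "\<dots> \<le> T"
      unfolding T_def using that B(1) by (intro member_le_sum) (auto simp: orthonormal_F_def)
    finally show ?thesis .
  qed
  define u where "u = (\<lambda>n l. \<Sum>e\<in>B. conj (coeff (p e l) n) *s e)"
  have "\<omega> = (\<Sum>n\<le>T. \<Sum>l=1..L. measurement A b \<omega> x0 l n *s u n l)" if \<omega>: "\<omega> \<in> W" for \<omega> x0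
  proof -
    have e: "inner_F \<omega> e = (\<Sum>n\<le>T. \<Sum>l=1..L. conj (coeff (p e l) n) * measurement A b \<omega> x0 l n)"
      if "e \<in> B" for e
    proof -
      \<comment> \<open>The first term vanishes by the syzygy; in the second,
        \<open>\<omega>\<close> in \<open>W\<close> sees a vector only through its
        projection.\<close>
      have "inner_F \<omega> e = inner_F x0 (\<Sum>l=1..L. poly_op (p e l) A (b l))
          + inner_F \<omega> (\<Sum>l=1..L. poly_op (poly_hat (p e l)) A (b l))"
        using p[OF that] inner_F_orth_proj_right[OF W \<omega>] by (metis add_0 inner_F_zero_right)
      also have "\<dots> = (\<Sum>l=1..L. \<Sum>n\<le>T. conj (coeff (p e l) n) * measurement A b \<omega> x0 l n)"
        using measurement_combination[OF A poly_as_sum_of_monoms'[OF T, symmetric]] that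
        by (simp add: inner_F_sum_right sum.distrib)
      finally show ?thesis by (subst sum.swap)
    qed
    have "\<omega> = (\<Sum>e\<in>B. inner_F \<omega> e *s e)" by (rule B(3)[OF \<omega>])
    also have "\<dots> = (\<Sum>e\<in>B. \<Sum>n\<le>T. \<Sum>l=1..L. measurement A b \<omega> x0 l n *s (conj (coeff (p e l) n) *s e))"
      by (intro sum.cong refl) (simp add: e vec.scale_sum_left mult.commute)
    also have "\<dots> = (\<Sum>n\<le>T. \<Sum>e\<in>B. \<Sum>l=1..L. measurement A b \<omega> x0 l n *s (conj (coeff (p e l) n) *s e))"
      by (rule sum.swap)
    also have "\<dots> = (\<Sum>n\<le>T. \<Sum>l=1..L. \<Sum>e\<in>B. measurement A b \<omega> x0 l n *s (conj (coeff (p e l) n) *s e))"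
      by (intro sum.cong refl sum.swap)
    also have "\<dots> = (\<Sum>n\<le>T. \<Sum>l=1..L. measurement A b \<omega> x0 l n *s u n l)"
      by (simp only: u_def vec.scale_sum_right)
    finally show ?thesis .
  qed
  then show ?thesis
    unfolding complete_source_recovery_def by (intro exI[of _ T] exI[of _ u] allI ballI)
qed

section \<open>Triangular generation of the syzygies by the conductors\<close>

theorem theorem2p11:
  fixes A :: "'a::real_or_complex ^ 'd \<Rightarrow> 'a ^ 'd"
    and W :: "('a ^ 'd) set"
    and L :: nat
    and b :: "nat \<Rightarrow> 'a ^ 'd"
    and V :: "nat \<Rightarrow> ('a ^ 'd) set"
    and \<kappa> :: "nat \<Rightarrow> 'a poly"
    and q :: "nat \<Rightarrow> nat \<Rightarrow> 'a poly"
    and g :: "nat \<Rightarrow> 'a ^ 'd"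
  assumes "Vector_Spaces.linear (*s) (*s) A"
    and "vec.subspace W"
    and "\<And>j. j \<in> {1..L} \<Longrightarrow> b j \<noteq> 0"
    and "\<And>j. j \<in> {1..L} \<Longrightarrow> V j = (\<Sum>i=1..<j. cyclic_subspace A (b i))"
    and "\<And>j. j \<in> {1..L} \<Longrightarrow> \<kappa> j = min_conductor A (V j) (b j)"
    and "\<And>j. j \<in> {2..L} \<Longrightarrow>
           poly_op (\<kappa> j) A (b j) = (\<Sum>i=1..<j. poly_op (q j i) A (b i))"
    and "\<And>j. j \<in> {1..L} \<Longrightarrow>
           g j = poly_op (poly_hat (\<kappa> j)) A (b j)
                 - (\<Sum>i=1..<j. poly_op (poly_hat (q j i)) A (b i))"
  shows "complete_source_recovery A W L b \<longleftrightarrow>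
           L \<ge> vec.dim W \<and> vec.span ((\<lambda>j. orth_proj W (g j)) ` {1..L}) = W"
proof -
  note A = assms(1) and W = assms(2) and g = assms(7)
  have \<kappa>: "poly_op p A (b j) \<in> V j \<longleftrightarrow> \<kappa> j dvd p" if "j \<in> {1..L}" for j p
  proof -
    have "vec.subspace (V j) \<and> (\<forall>v\<in>V j. A v \<in> V j)"
      unfolding assms(4)[OF that]
      by (rule sum_subspaces_props[OF A])
         (auto simp: cyclic_subspace_def vec.subspace_span intro: cyclic_subspace_invariant[OF A, unfolded cyclic_subspace_def])
    then show ?thesis unfolding assms(5)[OF that] by (intro min_conductor_props[OF A]) auto
  qed
  \<comment> \<open>For \<open>j = 1\<close> the space \<open>V j\<close> is the empty sum
    \<open>{0}\<close>, so the relation holds there with an empty right-hand side.\<close>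
  have relation: "poly_op (\<kappa> j) A (b j) = (\<Sum>i=1..<j. poly_op (q j i) A (b i))" if j: "j \<in> {1..L}" for j
  proof (cases "j = 1")
    case True
    have "poly_op (\<kappa> j) A (b j) \<in> V j" using \<kappa>[OF j] by simp
    then show ?thesis using assms(4)[OF j] True by simp
  qed (use assms(6) j in auto)

  \<comment> \<open>Elimination by induction on the number of vectors: the last coefficient of a
    syzygy is a multiple of the last conductor.\<close>
  have subset: "(\<Sum>l=1..m. poly_op (poly_hat (p l)) A (b l)) \<in> vec.span (g ` {1..m})"
    if "m \<le> L" "(\<Sum>l=1..m. poly_op (p l) A (b l)) = 0" for m p
    using that
  proof (induction m arbitrary: p)
    case 0
    then show ?case by simp
  next
    case (Suc m)
    let ?j = "Suc m"
    have j: "?j \<in> {1..L}" using Suc.prems by simp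
    have ivl: "{1..<?j} = {1..m}" by auto
    have "poly_op (p ?j) A (b ?j) = (\<Sum>l=1..m. poly_op (- p l) A (b l))"
      using Suc.prems(2) by (simp add: poly_op_uminus sum_negf add_eq_0_iff)
    also have "\<dots> \<in> V ?j"
      unfolding assms(4)[OF j] ivl by (intro sum_mem_sum_sets poly_op_mem_cyclic) simp
    finally obtain s where s: "p ?j = s * \<kappa> ?j"
      using \<kappa>[OF j] by (metis dvd_def mult.commute)
    \<comment> \<open>The first \<open>m\<close> entries left after subtracting \<open>s\<close>
      times the generator of index \<open>?j\<close>, whose earlier entries are
      \<open>- q ?j l\<close>.\<close>
    define p' where "p' = (\<lambda>l. p l + s * q ?j l)"
    have lin: "poly_op r A (\<Sum>l=1..m. f l) = (\<Sum>l=1..m. poly_op r A (f l))" for r f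
      using vec.linear_sum[OF linear_poly_op[OF A]] by blast
    \<comment> \<open>Used with \<open>r = s\<close> to see that \<open>p'\<close> is a syzygy, and
      with \<open>r = poly_hat s\<close> to cancel the cross terms of the product rule, leaving
      \<open>poly s 1 *s g ?j\<close>.\<close>
    have rel: "poly_op (r * \<kappa> ?j) A (b ?j) = (\<Sum>l=1..m. poly_op (r * q ?j l) A (b l))" for r
      unfolding poly_op_mult[OF A] relation[OF j] ivl by (rule lin)
    have "(\<Sum>l=1..m. poly_op (p' l) A (b l)) = 0"
      using Suc.prems(2) by (simp add: p'_def poly_op_add sum.distrib s rel)
    then have IH: "(\<Sum>l=1..m. poly_op (poly_hat (p' l)) A (b l)) \<in> vec.span (g ` {1..m})"
      using Suc.IH Suc.prems(1) by simp
    have "(\<Sum>l=1..?j. poly_op (poly_hat (p l)) A (b l))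
        = (\<Sum>l=1..m. poly_op (poly_hat (p' l)) A (b l)) + poly s 1 *s g ?j"
      unfolding g[OF j] ivl
      by (simp add: p'_def s poly_hat_add poly_hat_mult poly_op_add poly_op_smult sum.distrib
        vec.scale_right_diff_distrib vec.scale_sum_right rel)
    also have "\<dots> \<in> vec.span (g ` {1..?j})"
      by (intro vec.span_add[OF subsetD[OF vec.span_mono IH] vec.span_scale[OF vec.span_base]]) auto
    finally show ?case .
  qed
  have g_mem: "g j \<in> source_functionals A L b" if j: "j \<in> {1..L}" for j
  proof -
    \<comment> \<open>The generator of index \<open>j\<close>, padded with zeros up to
      \<open>L\<close>.\<close>
    define p where "p = (\<lambda>l. if l = j then \<kappa> j else if l < j then - q j l else 0)"
    \<comment> \<open>Stated for general \<open>f\<close> so that it serves both the syzygy and its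
      hatted version.\<close>
    have split: "(\<Sum>l=1..L. f (p l) l) = f (\<kappa> j) j + (\<Sum>l=1..<j. f (- q j l) l)"
      if "\<And>l. f 0 l = 0" for f :: "'a poly \<Rightarrow> nat \<Rightarrow> 'a ^ 'd"
    proof -
      have "(\<Sum>l=1..L. f (p l) l) = (\<Sum>l\<in>insert j {1..<j}. f (p l) l)"
        using j that by (intro sum.mono_neutral_right) (auto simp: p_def)
      also have "\<dots> = f (\<kappa> j) j + (\<Sum>l=1..<j. f (- q j l) l)"
        by (simp add: p_def)
      finally show ?thesis .
    qed
    have "(\<Sum>l=1..L. poly_op (p l) A (b l)) = 0"
      using split[of "\<lambda>r l. poly_op r A (b l)"]
      by (simp add: relation[OF j] poly_op_uminus sum_negf)
    moreover have "(\<Sum>l=1..L. poly_op (poly_hat (p l)) A (b l)) = g j"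
      using split[of "\<lambda>r l. poly_op (poly_hat r) A (b l)"]
      by (simp add: g[OF j] poly_hat_uminus poly_op_uminus sum_negf)
    ultimately show ?thesis unfolding source_functionals_def by (intro CollectI exI[of _ p]) simp
  qed
  have "source_functionals A L b = vec.span (g ` {1..L})"
    using subset[OF order_refl] g_mem
    by (intro equalityI vec.span_minimal subspace_source_functionals)
       (auto simp: source_functionals_def)
  then have image: "orth_proj W ` source_functionals A L b = vec.span ((\<lambda>j. orth_proj W (g j)) ` {1..L})"
    using vec.linear_span_image[OF linear_orth_proj[OF W], of "g ` {1..L}"] by (simp add: image_image)
  have dim: "vec.dim W \<le> L" if "vec.span ((\<lambda>j. orth_proj W (g j)) ` {1..L}) = W"
  proof -
    \<comment> \<open>\<open>W\<close> is spanned by an image of \<open>{1..L}\<close>, hence by at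
      most \<open>L\<close> vectors.\<close>
    have "vec.dim W \<le> card ((\<lambda>j. orth_proj W (g j)) ` {1..L})"
      using that by (intro vec.dim_le_card) auto
    also have "\<dots> \<le> L" using card_image_le[of "{1..L}"] by simp
    finally show ?thesis .
  qed
  have "complete_source_recovery A W L b \<longleftrightarrow> orth_proj W ` source_functionals A L b = W"
    by (rule iffI[OF orth_proj_source_functionals_if_complete[OF A W]
      complete_if_orth_proj_source_functionals[OF A W]])
  then show ?thesis
    unfolding image using dim by argo
qed

end
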